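(* Let $p$ be a prime, $f\ge 1$, $q=p^f$, let $k\mid q-1$, and let $A_k=\{x^k : x\in\mathbb{F}_q^\times\}$ be a proper subgroup of $\mathbb{F}_q^\times$ (i.e. $A_k\neq\mathbb{F}_q^\times$) such that $\mathbb{F}_p(A_k)=\mathbb{F}_q$. Then $A_k$, regarded as a subset of the additive group of $\mathbb{F}_q$, is a generalized arithmetic progression (GAP) if and only if $|A_k|\in\{1,2,4\}$.
   Context: For $k\mid q-1$, $A_k$ is the unique subgroup of index $k$ in the cyclic group $\mathbb{F}_q^\times$; every subgroup has this form. $\mathbb{F}_p(A_k)$ denotes the smallest subfield of $\mathbb{F}_q$ containing $A_k$. For $r\ge1$, a rank-$r$ generalized arithmetic progression (GAP) in an abelian group is a set $P=a+[0,L_1-1]d_1+\cdots+[0,L_r-1]d_r=\{a+n_1d_1+\cdots+n_rd_r : n_i\in\mathbb{Z},\ 0\le n_i\le L_i-1\}$, where $L_i\ge 2$ are integers and each $d_i\neq 0$; the parametrization is not required to be injective. A singleton is a rank-zero GAP. A GAP is a GAP of some rank $r\ge0$. *)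

theory Defs
  imports
    "HOL-Computational_Algebra.Primes"
    "HOL-Library.Cardinality"
    "HOL-Algebra.Generated_Fields"
    "HOL-Algebra.Algebraic_Closure_Type"
begin

text \<open>
  The group of units of the field is the set of its nonzero elements. When \<^term>\<open>k\<close> divides
  \<open>q - 1\<close>, where \<open>q\<close> is the number of elements, this is the subgroup of index \<^term>\<open>k\<close>.
\<close>
definition power_subgroup :: "nat \<Rightarrow> 'a::field set"
  where "power_subgroup k = {x ^ k | x. x \<noteq> 0}"

text \<open>
  The smallest subfield containing a set, in type-class form; it contains the prime field, so it is
  \<open>F\<^sub>p(A)\<close> in characteristic \<open>p\<close>.
\<close>
definition adjoin :: "'a::field set \<Rightarrow> 'a set"
  where "adjoin A = generate_field ring_of_type_algebra A"

text \<open>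
  An abelian group has no scalar multiplication by natural numbers in the library: the inner sum of
  \<open>n i\<close> copies of \<open>d i\<close> is the multiple \<open>n\<^sub>i d\<^sub>i\<close>. The values \<open>n i\<close> for \<open>i \<ge> r\<close> play no role.
  For \<open>r = 0\<close> these are the singletons.
\<close>
definition gap_of_rank :: "nat \<Rightarrow> 'a::ab_group_add set \<Rightarrow> bool"
  where "gap_of_rank r P \<longleftrightarrow>
    (\<exists>a (L :: nat \<Rightarrow> nat) d. (\<forall>i<r. L i \<ge> 2 \<and> d i \<noteq> 0) \<and>
      P = {a + (\<Sum>i<r. \<Sum>j<n i. d i) | n. \<forall>i<r. n i \<le> L i - 1})"

definition is_gap :: "'a::ab_group_add set \<Rightarrow> bool"
  where "is_gap P \<longleftrightarrow> (\<exists>r. gap_of_rank r P)"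

end

theory Submission
  imports Defs
begin

text \<open>
  Let \<open>n = |A|\<close>. A progression of positive rank has the form \<open>A = Q \<union> (Q + d)\<close> with \<open>d \<noteq> 0\<close>. By the method
  of Hanson and Petridis, \<open>F = (X + d)\<^sup>n\<^sup>+\<^sup>1 - X\<^sup>n\<^sup>+\<^sup>1 - d\<close> has a double root at every point of \<open>Q\<close>,
  because \<open>x\<^sup>n = (x + d)\<^sup>n = 1\<close> there. If \<open>n + 1 \<noteq> 0\<close> in the field, then \<open>F\<close> has degree \<open>n\<close>, hence
  \<open>|Q| = n/2\<close>, the union is disjoint and \<open>F\<close> is a constant times the square of \<open>G = \<Prod>\<^bsub>x\<in>Q\<^esub> (X - x)\<close>.
  If \<open>n + 1 = P m\<close> with \<open>P > 1\<close> a power of \<open>p\<close> and \<open>p\<close> not dividing \<open>m\<close>, then \<open>F\<close> is a \<open>P\<close>-th power, which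
  forces \<open>|Q| < m\<close>, too small, unless \<open>m = 1\<close>; in that case \<open>A \<union> {0}\<close> is a subfield, so it is everything.

  Centre \<open>Q\<close> at \<open>R = Q + e\<close> with \<open>e = d/2\<close>. The power sums of \<open>A\<close> of degree between \<open>0\<close> and \<open>n\<close> vanish, which
  determines the power sums of \<open>R\<close> of degree 1, 2 and 4 when \<open>n > 4\<close>, and with them the leading coefficients
  of \<open>G\<close>. Comparing with the coefficients of \<open>F\<close>, degree 2 forces \<open>n = 4\<close> in the field, and degree 4 then
  gives \<open>16 = 0\<close>, although \<open>p\<close> is odd.
\<close>

section \<open>Root multiplicities and differences of shifted powers\<close>

lemma prod_linear_power_dvd:
  fixes p :: "'a::field poly"
  assumes "finite S" and "\<And>x. x \<in> S \<Longrightarrow> [:-x, 1:] ^ k dvd p"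
  shows "(\<Prod>x\<in>S. [:-x, 1:] ^ k) dvd p"
  using assms
proof (induction S arbitrary: p rule: finite_induct)
  case (insert x S)
  then obtain q where q: "p = [:-x, 1:] ^ k * q"
    by (meson dvdE insertI1)
  have "[:-y, 1:] ^ k dvd q" if "y \<in> S" for y
  proof (cases "q = 0")
    case False
    \<comment> \<open>The factor split off at \<open>x\<close> does not vanish at \<open>y\<close>,
      so the cofactor \<open>q\<close> keeps the full order of \<open>p\<close> at
      \<open>y\<close>.\<close>
    have "poly ([:-x, 1:] ^ k) y \<noteq> 0"
      using that insert.hyps by auto
    then have "Polynomial.order y ([:-x, 1:] ^ k) = 0"
      by (rule order_0I)
    moreover have "k \<le> Polynomial.order y p"
      using insert.prems[of y] that False q by (simp add: order_divides)
    ultimately show ?thesis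
      using False q by (simp add: order_divides order_mult)
  qed simp
  then have "(\<Prod>y\<in>S. [:-y, 1:] ^ k) dvd q"
    by (rule insert.IH)
  then show ?case
    using insert.hyps q by (simp add: mult_dvd_mono)
qed simp

lemma double_root_dvd:
  fixes p :: "'a::field poly"
  assumes "poly p x = 0" and "poly (pderiv p) x = 0"
  shows "[:-x, 1:] ^ 2 dvd p"
proof -
  obtain q where q: "p = [:-x, 1:] * q"
    using assms(1) by (auto simp: poly_eq_0_iff_dvd)
  then have "poly q x = 0"
    using assms(2) by (simp add: pderiv_mult pderiv_pCons del: mult_pCons_left)
  then have "[:-x, 1:] dvd q"
    by (simp add: poly_eq_0_iff_dvd)
  then show ?thesis
    unfolding q power2_eq_square by (rule mult_dvd_mono[OF dvd_refl])
qed

lemma degree_prod_linear: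
  fixes S :: "'a::field set"
  shows "degree (\<Prod>x\<in>S. [:-x, 1:]) = card S"
  by (subst degree_prod_eq_sum_degree) auto

text \<open>The polynomial \<open>F\<close> of the overview is the case \<open>u = d\<close>,
  \<open>v = 0\<close>, \<open>c = d\<close>. The free parameters also admit the shifts
  \<open>e\<close> and \<open>-e\<close> of the centred set, and the exponent \<open>m\<close> with
  another constant.\<close>

definition shift_poly :: "nat \<Rightarrow> 'a::field \<Rightarrow> 'a \<Rightarrow> 'a \<Rightarrow> 'a poly"
  where "shift_poly n u v c = [:u, 1:] ^ (n + 1) - [:v, 1:] ^ (n + 1) - [:c:]"

lemma coeff_shift_poly:
  assumes "0 < i" and "i \<le> n + 1"
  shows "coeff (shift_poly n u v c) i =
    of_nat ((n + 1) choose i) * (u ^ (n + 1 - i) - v ^ (n + 1 - i))"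
proof -
  have "coeff [:c:] i = 0"
    using assms by (cases i) auto
  then show ?thesis
    using assms unfolding shift_poly_def
    by (simp only: coeff_diff coeff_linear_poly_power) (simp add: algebra_simps)
qed

lemma coeff_shift_poly_top:
  "0 < n \<Longrightarrow> coeff (shift_poly n u v c) n = of_nat (n + 1) * (u - v)"
  by (subst coeff_shift_poly) (auto simp: algebra_simps)

text \<open>The leading terms \<open>X ^ (n + 1)\<close> cancel.\<close>

lemma degree_shift_poly_le: "degree (shift_poly n u v c) \<le> n"
proof (rule degree_le, intro allI impI)
  fix i assume "n < i"
  show "coeff (shift_poly n u v c) i = 0"
  proof (cases "i = n + 1")
    case False
    have "degree ([:w, 1:] ^ (n + 1)) = n + 1" for w :: 'a
      by (rule degree_linear_power)
    then have "coeff ([:w, 1:] ^ (n + 1)) i = 0" for w :: 'a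
      using \<open>n < i\<close> False by (intro coeff_eq_0) simp
    moreover have "coeff [:c:] i = 0"
      using \<open>n < i\<close> by (cases i) auto
    ultimately show ?thesis
      by (simp add: shift_poly_def del: power_Suc)
  qed (simp add: coeff_shift_poly)
qed

text \<open>At a point of \<open>S\<close> the polynomial takes the value
  \<open>(x + u) - (x + v) - (u - v)\<close> and its derivative the value
  \<open>(n + 1) (1 - 1)\<close>, so every such root is double.\<close>

lemma prod_linear_square_dvd_shift_poly:
  fixes S :: "'a::field set"
  assumes "finite S" and S: "\<And>x. x \<in> S \<Longrightarrow> (x + u) ^ n = 1 \<and> (x + v) ^ n = 1"
  shows "(\<Prod>x\<in>S. [:-x, 1:]) ^ 2 dvd shift_poly n u v (u - v)"
proof -
  have "[:-x, 1:] ^ 2 dvd shift_poly n u v (u - v)" if "x \<in> S" for x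
  proof (rule double_root_dvd)
    show "poly (shift_poly n u v (u - v)) x = 0"
      using S[OF that] by (simp add: shift_poly_def add.commute)
    have "pderiv ([:w, 1:] ^ (n + 1)) = smult (of_nat (n + 1)) ([:w, 1:] ^ n)" for w :: 'a
      using pderiv_power_Suc[of "[:w, 1:]" n] by (simp add: pderiv_pCons)
    then have "pderiv (shift_poly n u v (u - v)) =
        smult (of_nat (n + 1)) ([:u, 1:] ^ n) - smult (of_nat (n + 1)) ([:v, 1:] ^ n)"
      by (simp add: shift_poly_def pderiv_diff pderiv_pCons del: power_Suc)
    then show "poly (pderiv (shift_poly n u v (u - v))) x = 0"
      using S[OF that] by (simp add: add.commute)
  qed
  then show ?thesis
    using prod_linear_power_dvd[OF \<open>finite S\<close>] by (simp add: prod_power_distrib)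
qed

section \<open>Newton's identities\<close>

lemma newton_identity:
  fixes R :: "'a::field set"
  defines "W \<equiv> \<Prod>x\<in>R. [:1, -x:]"
  assumes "finite R"
  shows "of_nat (Suc k) * coeff W (Suc k) = - (\<Sum>i\<le>k. (\<Sum>x\<in>R. x ^ Suc i) * coeff W (k - i))"
proof -
  \<comment> \<open>The product without the factor of \<open>x\<close> is
    \<open>W / (1 - x X)\<close>, that is, \<open>W\<close> times the geometric series in
    \<open>x X\<close>. Weighted by \<open>-x\<close>, these cofactors add up to the derivative of
    \<open>W\<close>.\<close>
  have deflate: "coeff (\<Prod>y\<in>R - {x}. [:1, -y:]) j = (\<Sum>i\<le>j. x ^ i * coeff W (j - i))" if "x \<in> R" for x j
  proof (induction j)
    case 0
    show ?case
      by (simp add: W_def poly_prod flip: poly_0_coeff_0)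
  next
    case (Suc j)
    let ?V = "\<Prod>y\<in>R - {x}. [:1, -y:]"
    have "W = [:1, -x:] * ?V"
      unfolding W_def using prod.remove[OF \<open>finite R\<close> that] .
    then have "coeff ?V (Suc j) = coeff W (Suc j) + x * coeff ?V j"
      by simp
    also have "\<dots> = (\<Sum>i\<le>Suc j. x ^ i * coeff W (Suc j - i))"
      unfolding Suc.IH sum.atMost_Suc_shift by (simp add: sum_distrib_left mult.assoc)
    finally show ?case .
  qed
  have "pderiv W = (\<Sum>x\<in>R. (\<Prod>y\<in>R - {x}. [:1, -y:]) * [:-x:])"
    unfolding W_def pderiv_prod by (simp add: pderiv_pCons)
  then have "coeff (pderiv W) k = (\<Sum>x\<in>R. coeff (\<Prod>y\<in>R - {x}. [:1, -y:]) k * (-x))"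
    by (simp add: coeff_sum mult.commute)
  also have "\<dots> = (\<Sum>x\<in>R. - (\<Sum>i\<le>k. x ^ Suc i * coeff W (k - i)))"
    by (intro sum.cong) (simp_all add: deflate sum_distrib_left sum_distrib_right sum_negf mult_ac)
  also have "\<dots> = - (\<Sum>i\<le>k. (\<Sum>x\<in>R. x ^ Suc i) * coeff W (k - i))"
    by (subst sum_negf, subst sum.swap) (simp add: sum_distrib_right)
  finally show ?thesis
    by (simp only: coeff_pderiv)
qed

section \<open>Progressions as unions of two translates\<close>

lemma is_gap_cases:
  fixes P :: "'a::ab_group_add set"
  assumes "is_gap P"
  obtains a where "P = {a}"
  | Q d where "d \<noteq> 0" and "P = Q \<union> (\<lambda>x. x + d) ` Q"
proof -
  obtain r a and L :: "nat \<Rightarrow> nat" and d :: "nat \<Rightarrow> 'a"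
    where Ld: "\<And>i. i < r \<Longrightarrow> L i \<ge> 2 \<and> d i \<noteq> 0"
    and P: "P = {a + (\<Sum>i<r. \<Sum>j<n i. d i) | n. \<forall>i<r. n i \<le> L i - 1}"
    using assms unfolding is_gap_def gap_of_rank_def by blast
  show ?thesis
  proof (cases "r = 0")
    case True
    then show ?thesis
      using that(1)[of a] P by simp
  next
    case False
    define s where "s n = a + (\<Sum>i<r. \<Sum>j<n i. d i)" for n :: "nat \<Rightarrow> nat"
    have s_in: "s n \<in> P" if "\<forall>i<r. n i \<le> L i - 1" for n
      using that unfolding P s_def by blast
    have s_upd: "s (n(0 := m)) = s (n(0 := 0)) + (\<Sum>j<m. d 0)" for n m
    proof -
      have "(\<Sum>i<r. \<Sum>j<(n(0 := m)) i. d i) = (\<Sum>j<m. d 0) + (\<Sum>i\<in>{..<r} - {0}. \<Sum>j<n i. d i)" for m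
        using False by (subst sum.remove[of _ 0]) auto
      then show ?thesis
        unfolding s_def by (simp del: fun_upd_apply add: algebra_simps)
    qed
    have s_Suc: "s (n(0 := Suc m)) = s (n(0 := m)) + d 0" for n m
      using s_upd[of n m] s_upd[of n "Suc m"] by (simp add: add.assoc)
    let ?Q = "{x \<in> P. x + d 0 \<in> P}"
    have "x \<in> ?Q \<union> (\<lambda>x. x + d 0) ` ?Q" if "x \<in> P" for x
    proof -
      obtain n where x: "x = s n" and n: "\<forall>i<r. n i \<le> L i - 1"
        using \<open>x \<in> P\<close> unfolding P s_def by blast
      \<comment> \<open>A point below the top of side 0 can move up by \<open>d 0\<close>; one at
        the top can move down, because \<open>L 0\<close> is at least 2.\<close>
      show ?thesis
      proof (cases "n 0 < L 0 - 1")
        case True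
        have "s (n(0 := Suc (n 0))) \<in> P"
          using True n by (intro s_in) auto
        then show ?thesis
          using s_Suc[of n "n 0"] x \<open>x \<in> P\<close> by simp
      next
        case f: False
        then obtain m where m: "n 0 = Suc m"
          using Ld[of 0] False by (cases "n 0") auto
        have "s (n(0 := m)) \<in> P"
          using m n by (intro s_in) (auto simp: Suc_le_eq intro: less_imp_le)
        moreover have "s (n(0 := m)) + d 0 = x"
          using s_Suc[of n m] m x by (metis fun_upd_triv)
        ultimately show ?thesis
          using \<open>x \<in> P\<close> by blast
      qed
    qed
    then have "P = ?Q \<union> (\<lambda>x. x + d 0) ` ?Q"
      by blast
    then show ?thesis
      using that(2) Ld[of 0] False by blast
  qed
qed

section \<open>Subgroups of the unit group as roots of unity\<close>

lemma card_power_eq_one_le: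
  fixes m :: nat
  assumes "0 < m"
  shows "card {x::'a::field. x ^ m = 1} \<le> m"
proof -
  have "coeff (monom (1::'a) m - 1) m = 1"
    using assms by simp
  then have "monom (1::'a) m - 1 \<noteq> 0"
    by fastforce
  then have "card {x. poly (monom (1::'a) m - 1) x = 0} \<le> degree (monom (1::'a) m - 1)"
    by (rule card_poly_roots_bound)
  also have "\<dots> \<le> m"
    by (intro degree_diff_le) (auto simp: degree_monom_le)
  finally show ?thesis
    by (simp add: poly_monom)
qed

text \<open>Multiplication by an element of \<open>A\<close> permutes \<open>A\<close>, so comparing
  products gives \<open>x ^ card A = 1\<close>; a root count excludes further solutions. The later
  lemmas see the subgroup only through this description.\<close>

lemma power_subgroup_eq_roots_of_unity:
  fixes A :: "'a::{field,finite} set"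
  assumes "A = power_subgroup k"
  shows "A = {x. x ^ card A = 1}" and "0 < card A"
proof -
  have "1 \<in> A"
    unfolding assms power_subgroup_def by (auto intro!: exI[of _ 1])
  then show pos: "0 < card A"
    by (auto simp: card_gt_0_iff)
  have nz: "x \<noteq> 0" if "x \<in> A" for x
    using that unfolding assms power_subgroup_def by auto
  have mul: "x * y \<in> A" if "x \<in> A" "y \<in> A" for x y
    using that unfolding assms power_subgroup_def
    by (auto simp flip: power_mult_distrib)
  have "x ^ card A = 1" if "x \<in> A" for x
  proof -
    have inj: "inj_on ((*) x) A"
      using nz[OF that] by (auto simp: inj_on_def)
    moreover have "(*) x ` A = A"
      using mul[OF that] inj by (intro card_subset_eq) (auto simp: card_image)
    ultimately have "\<Prod>A = (\<Prod>y\<in>A. x * y)"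
      by (metis prod.reindex_cong)
    also have "\<dots> = x ^ card A * \<Prod>A"
      by (simp add: prod.distrib)
    finally show ?thesis
      using nz by (auto simp: prod_zero_iff)
  qed
  then have "A \<subseteq> {x. x ^ card A = 1}"
    by blast
  then show "A = {x. x ^ card A = 1}"
    using card_power_eq_one_le[OF pos, where 'a = 'a]
    by (intro card_seteq) auto
qed

section \<open>Frobenius powers and their fixed fields\<close>

lemma frobenius_add:
  fixes x y :: "'a::{field,finite}"
  assumes "P = CHAR('a) ^ s"
  shows "(x + y) ^ P = x ^ P + y ^ P"
  by (rule freshmans_dream'[OF _ assms]) (simp add: prime_CHAR_semidom finite_imp_CHAR_pos)

lemma frobenius_diff:
  fixes x y :: "'a::{field,finite}"
  assumes "P = CHAR('a) ^ s"
  shows "(x - y) ^ P = x ^ P - y ^ P"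
  using frobenius_add[OF assms, of "x - y" y] by simp

lemma frobenius_inject:
  fixes x y :: "'a::{field,finite}"
  assumes "P = CHAR('a) ^ s" and "x ^ P = y ^ P"
  shows "x = y"
  using frobenius_diff[OF assms(1), of x y] assms(2) by simp

text \<open>The fixed points of the \<open>P\<close>-th power map form a subfield; the induction
  checks its closure properties.\<close>

lemma adjoin_subset_frobenius_fixed:
  fixes A :: "'a::{field,finite} set"
  assumes "P = CHAR('a) ^ s"
  assumes A: "\<And>x. x \<in> A \<Longrightarrow> x ^ P = x"
  shows "adjoin A \<subseteq> {x. x ^ P = x}"
proof
  fix x assume "x \<in> adjoin A"
  let ?R = "ring_of_type_algebra :: 'a ring"
  interpret R: field ?R ..
  have prime: "prime CHAR('a)"
    by (rule prime_CHAR_semidom) (simp add: finite_imp_CHAR_pos)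
  then have P: "0 < P"
    by (simp add: assms prime_gt_0_nat)
  have ops: "\<And>x y. x \<oplus>\<^bsub>?R\<^esub> y = x + y" "\<And>x y. x \<otimes>\<^bsub>?R\<^esub> y = x * y" "\<one>\<^bsub>?R\<^esub> = 1" "\<zero>\<^bsub>?R\<^esub> = 0"
    "carrier ?R = UNIV"
    by (auto simp: ring_of_type_algebra_def)
  have minus: "\<ominus>\<^bsub>?R\<^esub> x = - x" for x
    using R.l_neg[of x] by (simp add: ops eq_neg_iff_add_eq_0)
  have inv: "inv\<^bsub>?R\<^esub> x = inverse x" if "x \<noteq> 0" for x
    by (rule R.inv_char) (use that in \<open>auto simp: ops\<close>)
  have "x \<in> generate_field ?R A"
    using \<open>x \<in> adjoin A\<close> by (simp add: adjoin_def)
  then have "x ^ P = x"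
  proof induction
    case (a_inv h)
    \<comment> \<open>Additivity applied to \<open>-h + h\<close> avoids a case split on the parity
      of \<open>P\<close>.\<close>
    have "(- h) ^ P + h ^ P = 0"
      using frobenius_add[OF assms(1), of "-h" h] P by (simp add: power_0_left)
    then show ?case
      using a_inv by (simp add: minus eq_neg_iff_add_eq_0)
  next
    case (m_inv h)
    then show ?case
      by (simp add: inv ops power_inverse)
  qed (simp_all add: ops A frobenius_add[OF assms(1)] power_mult_distrib)
  then show "x \<in> {x. x ^ P = x}"
    by simp
qed

section \<open>Order and power sums of a group of roots of unity\<close>

lemma of_nat_card_roots_of_unity_nonzero:
  fixes A :: "'a::{field,finite} set"
  assumes A: "A = {x. x ^ card A = 1}" and pos: "0 < card A"
  shows "of_nat (card A) \<noteq> (0::'a)"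
proof
  have p: "prime CHAR('a)"
    by (rule prime_CHAR_semidom) (simp add: finite_imp_CHAR_pos)
  assume "of_nat (card A) = (0::'a)"
  then obtain m where m: "card A = CHAR('a) * m"
    by (auto simp: of_nat_eq_0_iff_char_dvd)
  then have "0 < m"
    using pos by (cases m) auto
  \<comment> \<open>Injectivity of Frobenius takes the \<open>p\<close>-th root of
    \<open>x ^ (p m) = 1\<close>, which leaves room for only \<open>m\<close> elements.\<close>
  have "x ^ m = 1" if "x \<in> A" for x
  proof (rule frobenius_inject)
    show "CHAR('a) = CHAR('a) ^ 1"
      by simp
    have "x ^ card A = 1"
      using that A by blast
    then show "(x ^ m) ^ CHAR('a) = 1 ^ CHAR('a)"
      by (simp add: m mult.commute flip: power_mult)
  qed
  then have "card A \<le> card {x::'a. x ^ m = 1}"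
    by (intro card_mono) auto
  also have "\<dots> \<le> m"
    by (rule card_power_eq_one_le[OF \<open>0 < m\<close>])
  finally show False
    using m \<open>0 < m\<close> prime_gt_1_nat[OF p] by simp
qed

text \<open>Since \<open>X ^ j - 1\<close> has fewer than \<open>card A\<close> roots, some
  \<open>b\<close> in \<open>A\<close> is not among them. Scaling by \<open>b\<close> permutes
  \<open>A\<close> and multiplies the sum by \<open>b ^ j\<close>.\<close>

lemma sum_power_roots_of_unity:
  fixes A :: "'a::{field,finite} set"
  assumes A: "A = {x. x ^ card A = 1}" and j: "0 < j" "j < card A"
  shows "(\<Sum>x\<in>A. x ^ j) = 0"
proof -
  have "\<not> A \<subseteq> {x. x ^ j = 1}"
    using card_power_eq_one_le[OF j(1), where 'a = 'a] card_mono[of "{x. x ^ j = 1}" A] j(2) by auto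
  then obtain b where b: "b \<in> A" "b ^ j \<noteq> 1"
    by blast
  have unit: "x ^ card A = 1" if "x \<in> A" for x
    using that A by blast
  have "b \<noteq> 0"
    using unit[OF b(1)] j by (metis power_0_left less_nat_zero_code zero_neq_one)
  then have inj: "inj_on ((*) b) A"
    by (auto simp: inj_on_def)
  have "b * x \<in> A" if "x \<in> A" for x
    using unit[OF b(1)] unit[OF that] by (subst A) (simp add: power_mult_distrib)
  then have "(*) b ` A = A"
    using inj by (intro card_subset_eq) (auto simp: card_image)
  then have "(\<Sum>x\<in>A. x ^ j) = (\<Sum>x\<in>A. (b * x) ^ j)"
    by (metis sum.reindex_cong inj)
  also have "\<dots> = b ^ j * (\<Sum>x\<in>A. x ^ j)"
    by (simp add: power_mult_distrib sum_distrib_left)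
  finally show ?thesis
    using b(2) by (simp add: algebra_simps)
qed

section \<open>Excluding \<open>n + 1 = 0\<close> in the field\<close>

lemma of_nat_Suc_card_nonzero:
  fixes A :: "'a::{field,finite} set"
  assumes A: "A = {x. x ^ card A = 1}" and pos: "0 < card A"
    and Q: "A = Q \<union> (\<lambda>x. x + d) ` Q" and d: "d \<noteq> 0"
    and proper: "A \<noteq> UNIV - {0}" and gen: "adjoin A = UNIV"
  shows "of_nat (card A + 1) \<noteq> (0::'a)"
proof
  assume "of_nat (card A + 1) = (0::'a)"
  then have dvd: "CHAR('a) dvd card A + 1"
    by (simp only: of_nat_eq_0_iff_char_dvd)
  have p: "prime CHAR('a)"
    by (rule prime_CHAR_semidom) (simp add: finite_imp_CHAR_pos)
  define s where "s = multiplicity CHAR('a) (card A + 1)"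
  define P where "P = CHAR('a) ^ s"
  obtain m where m: "card A + 1 = P * m" "\<not> CHAR('a) dvd m"
    unfolding P_def s_def using p
    by (metis add_is_0 multiplicity_decompose' not_prime_unit one_neq_zero)
  have "s > 0"
    using dvd m by (cases s) (auto simp: P_def)
  then have "CHAR('a) ^ 1 \<le> P"
    unfolding P_def using prime_gt_0_nat[OF p] by (intro power_increasing) auto
  then have "2 \<le> P"
    using prime_ge_2_nat[OF p] by simp
  have unit: "x ^ card A = 1" if "x \<in> A" for x
    using that A by blast
  show False
  proof (cases "m = 1")
    case True
    then have P: "P = Suc (card A)"
      using m by simp
    \<comment> \<open>Here \<open>P = n + 1\<close>, so the Frobenius fixed field contains
      \<open>A\<close>; by \<open>gen\<close> it is everything, and every unit lies in
      \<open>A\<close>.\<close>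
    have "x ^ P = x" if "x \<in> A" for x
      using unit[OF that] by (simp add: P)
    with adjoin_subset_frobenius_fixed[OF P_def, of A] have "x ^ P = x" for x :: 'a
      unfolding gen by blast
    then have "x * x ^ card A = x" for x :: 'a
      by (simp add: P)
    then have "x ^ card A = 1" if "x \<noteq> 0" for x :: 'a
      using that by (metis mult_cancel_left mult.right_neutral)
    then have "x \<in> A" if "x \<noteq> 0" for x
      using that by (subst A) simp
    moreover have "0 \<notin> A"
      using unit[of 0] zero_power[OF pos, where 'a = 'a] by auto
    ultimately show False
      using proper by blast
  next
    case False
    have "m \<noteq> 0"
      using m(2) by (metis dvd_0_right)
    with False have "2 \<le> m"
      by simp
    \<comment> \<open>Additivity of the \<open>P\<close>-th power turns this into
      \<open>(x + d) ^ (n + 1) - x ^ (n + 1)\<close>. By injectivity the difference of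
      \<open>m\<close>-th powers is then constant on \<open>Q\<close>; its value at a point
      \<open>y\<close> serves as the \<open>P\<close>-th root of \<open>d\<close>.\<close>
    have "((x + d) ^ m - x ^ m) ^ P = d" if "x \<in> Q" for x
    proof -
      have "x ^ (card A + 1) = x" "(x + d) ^ (card A + 1) = x + d"
        using unit[of x] unit[of "x + d"] that Q by auto
      then have "x ^ (P * m) = x" "(x + d) ^ (P * m) = x + d"
        by (simp_all only: m(1))
      then show ?thesis
        by (simp add: frobenius_diff[OF P_def] mult.commute flip: power_mult)
    qed
    moreover obtain y where "y \<in> Q"
      using pos Q by fastforce
    ultimately have *: "(x + d) ^ m - x ^ m = (y + d) ^ m - y ^ m" if "x \<in> Q" for x
      using frobenius_inject[OF P_def] that by metis
    define F where "F = shift_poly (m - 1) d 0 ((y + d) ^ m - y ^ m)"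
    have "coeff F (m - 1) = of_nat m * d"
      unfolding F_def using \<open>2 \<le> m\<close> by (subst coeff_shift_poly_top) auto
    then have "F \<noteq> 0"
      using m(2) d by (auto simp: of_nat_eq_0_iff_char_dvd)
    have "poly F x = 0" if "x \<in> Q" for x
      using *[OF that] \<open>2 \<le> m\<close> by (simp add: F_def shift_poly_def add.commute del: power_Suc)
    then have "card Q \<le> card {x. poly F x = 0}"
      by (intro card_mono) auto
    also have "\<dots> \<le> m - 1"
      using card_poly_roots_bound[OF \<open>F \<noteq> 0\<close>] degree_shift_poly_le[of "m - 1" d 0] 
      unfolding F_def by (meson le_trans)
    \<comment> \<open>At most \<open>m - 1\<close> points in \<open>Q\<close> give
      \<open>n \<le> 2 m - 2\<close>, whereas \<open>P \<ge> 2\<close> gives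
      \<open>n \<ge> 2 m - 1\<close>.\<close>
    finally have "card A \<le> 2 * (m - 1)"
      using card_Un_le[of Q "(\<lambda>x. x + d) ` Q"] card_image_le[of Q "\<lambda>x. x + d"] by (simp add: Q[symmetric])
    moreover have "2 * m \<le> card A + 1"
      using m(1) \<open>2 \<le> P\<close> by simp
    ultimately show False
      using \<open>2 \<le> m\<close> by linarith
  qed
qed

section \<open>Halving of \<open>A\<close> and the square identity\<close>

lemma shift_poly_eq_square:
  fixes S :: "'a::field set"
  assumes "finite S" and n: "n = 2 * card S" and "0 < n"
    and S: "\<And>x. x \<in> S \<Longrightarrow> (x + u) ^ n = 1 \<and> (x + v) ^ n = 1"
  shows "shift_poly n u v (u - v) = smult (of_nat (n + 1) * (u - v)) ((\<Prod>x\<in>S. [:-x, 1:]) ^ 2)"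
proof -
  let ?F = "shift_poly n u v (u - v)" and ?G = "(\<Prod>x\<in>S. [:-x, 1:]) ^ 2"
  obtain q where q: "?F = ?G * q"
    using prod_linear_square_dvd_shift_poly[OF \<open>finite S\<close> S] by (auto elim: dvdE)
  have monic: "lead_coeff ?G = 1"
    by (simp add: lead_coeff_power lead_coeff_prod)
  have deg: "degree ?G = n"
    by (simp add: degree_power_eq prod_zero_iff \<open>finite S\<close> degree_prod_linear n)
  \<comment> \<open>The square already has degree \<open>2 * card S = n\<close>, the largest
    possible for \<open>?F\<close>. The coefficient of \<open>X ^ n\<close> then identifies the
    constant.\<close>
  have "degree q = 0"
  proof (cases "q = 0")
    case False
    have "?G \<noteq> 0"
      using monic by fastforce
    then have "degree ?F = n + degree q"
      using False unfolding q by (simp add: degree_mult_eq deg)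
    then show ?thesis
      using degree_shift_poly_le[of n u v "u - v"] by simp
  qed simp
  then obtain c where c: "q = [:c:]"
    by (rule degree_eq_zeroE)
  then have "coeff ?F n = c * coeff ?G n"
    unfolding q by simp
  moreover have "coeff ?G n = 1"
    using monic unfolding deg .
  ultimately have "c = of_nat (n + 1) * (u - v)"
    using coeff_shift_poly_top[OF \<open>0 < n\<close>, of u v "u - v"] by simp
  then show ?thesis
    by (simp add: q c)
qed

text \<open>Double roots give \<open>2 |Q| \<le> n\<close>, the covering gives
  \<open>n \<le> 2 |Q|\<close>; equality leaves no room for overlap.\<close>

lemma translate_cover_card:
  fixes A :: "'a::{field,finite} set"
  assumes A: "A = {x. x ^ card A = 1}" and pos: "0 < card A"
    and Q: "A = Q \<union> (\<lambda>x. x + d) ` Q" and d: "d \<noteq> 0"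
    and n1: "of_nat (card A + 1) \<noteq> (0::'a)"
  shows "card A = 2 * card Q" and "Q \<inter> (\<lambda>x. x + d) ` Q = {}"
proof -
  have unit: "x ^ card A = 1" if "x \<in> A" for x
    using that A by blast
  let ?F = "shift_poly (card A) d 0 d" and ?G = "(\<Prod>x\<in>Q. [:-x, 1:])"
  have "?F \<noteq> 0"
    using coeff_shift_poly_top[OF pos, of d 0 d] n1 d by (metis coeff_0 diff_zero mult_eq_0_iff)
  moreover have "?G ^ 2 dvd ?F"
    using prod_linear_square_dvd_shift_poly[of Q d "card A" 0] unit Q by auto
  ultimately have "degree (?G ^ 2) \<le> degree ?F"
    by (intro dvd_imp_degree_le)
  also have "\<dots> \<le> card A"
    by (rule degree_shift_poly_le)
  finally have le: "2 * card Q \<le> card A"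
    by (simp add: degree_power_eq prod_zero_iff degree_prod_linear)
  have img: "card ((\<lambda>x. x + d) ` Q) = card Q"
    by (intro card_image) simp
  have "card A + card (Q \<inter> (\<lambda>x. x + d) ` Q) = card Q + card ((\<lambda>x. x + d) ` Q)"
    using card_Un_Int[of Q "(\<lambda>x. x + d) ` Q"] by (simp flip: Q)
  then have "card A = 2 * card Q \<and> card (Q \<inter> (\<lambda>x. x + d) ` Q) = 0"
    using le img by linarith
  then show "card A = 2 * card Q" and "Q \<inter> (\<lambda>x. x + d) ` Q = {}"
    by auto
qed

section \<open>Comparison of coefficients in degrees 2 and 4\<close>

lemma binomial_Suc_right: "Suc k * (n choose Suc k) = (n - k) * (n choose k)"
  by (simp only: binomial_absorption binomial_absorb_comp)

text \<open>
  The unknowns stand for \<open>n = |A|\<close> and \<open>h = |R|\<close> in the field, the coefficients \<open>g\<^sub>i\<close> of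
  \<open>\<Prod>\<^bsub>x\<in>R\<^esub> (1 - x X)\<close>, the power sums \<open>P\<^sub>i\<close> of \<open>R\<close> and the binomial coefficients of \<open>n + 1\<close> over 3 and 5.
  The identities for these avoid division, since the characteristic may be 3 or 5.
\<close>
lemma square_coeffs_contradiction:
  fixes n h e g1 g2 g3 g4 c3 c5 P1 P2 P3 P4 :: "'a::field"
  assumes two: "2 \<noteq> (0::'a)" and e: "e \<noteq> 0" and n: "n \<noteq> 0" "n + 1 \<noteq> 0" "n = 2 * h"
    and moments: "2 * P1 = 0" "2 * P2 + 2 * h * e ^ 2 = 0" "2 * P4 + 12 * e ^ 2 * P2 + 2 * h * e ^ 4 = 0"
    and newton: "g1 = - P1" "2 * g2 = - (P1 * g1 + P2)" "4 * g4 = - (P1 * g3 + P2 * g2 + P3 * g1 + P4)"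
    and square: "(n + 1) * (2 * e) * (2 * g2 + g1 ^ 2) = c3 * (2 * e ^ 3)"
      "(n + 1) * (2 * e) * (2 * g4 + 2 * g1 * g3 + g2 ^ 2) = c5 * (2 * e ^ 5)"
    and binom: "6 * c3 = (n + 1) * n * (n - 1)" "20 * c5 = c3 * (n - 2) * (n - 3)"
  shows False
proof -
  have "P1 = 0"
    using moments(1) two by simp
  then have g1: "g1 = 0"
    by (simp add: newton)
  have "2 * (P2 + h * e ^ 2) = 0"
    using moments(2) by (simp add: algebra_simps)
  then have P2: "P2 = - (h * e ^ 2)"
    using two by (metis mult_eq_0_iff eq_neg_iff_add_eq_0)
  have "2 * (P4 - 5 * h * e ^ 4) = 2 * P4 + 12 * e ^ 2 * P2 + 2 * h * e ^ 4"
    unfolding P2 by Groebner_Basis.algebra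
  then have P4: "P4 = 5 * h * e ^ 4"
    using moments(3) two by (metis mult_eq_0_iff right_minus_eq)
  have g2: "2 * g2 = h * e ^ 2"
    using newton(2) g1 P2 by simp
  have "(2 * e ^ 3) * ((n + 1) * h) = (2 * e ^ 3) * c3"
    using square(1) unfolding g1 g2 by (simp add: algebra_simps eval_nat_numeral)
  then have c3: "c3 = (n + 1) * h"
    using two e by simp
  \<comment> \<open>The degree 2 identity meets the formula for \<open>6 * c3\<close>; cancelling
    \<open>n (n + 1)\<close> leaves \<open>n - 1 = 3\<close>.\<close>
  have "(n + 1) * (n * 3) = 6 * c3"
    unfolding c3 using n(3) by Groebner_Basis.algebra
  also have "\<dots> = (n + 1) * (n * (n - 1))"
    using binom(1) by (simp add: mult.assoc)
  finally have "n - 1 = 3"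
    using n(1,2) by simp
  then have n4: "n = 4"
    by (simp add: algebra_simps)
  then have "2 * h = 2 * 2"
    using n(3) by simp
  then have h: "h = 2"
    using two by (metis mult_cancel_left)
  have "2 * g2 = 2 * e ^ 2"
    using g2 h by simp
  then have g2': "g2 = e ^ 2"
    using two by (metis mult_cancel_left)
  have five: "(5::'a) \<noteq> 0"
    using n(2) n4 by simp
  have "20 * c5 = 20"
    using binom(2) unfolding c3 n4 h by simp
  then have "(2 * 2 * 5) * c5 = (2 * 2 * 5) * 1"
    by simp
  then have c5: "c5 = 1"
    using two five by (metis mult_cancel_left mult_eq_0_iff)
  have "(2 * 2) * g4 = (2 * 2) * (- 2 * e ^ 4)"
    using newton(3) unfolding \<open>P1 = 0\<close> g1 P2 P4 g2' h by Groebner_Basis.algebra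
  then have "g4 = - 2 * e ^ 4"
    using two by (metis mult_cancel_left mult_eq_0_iff)
  \<comment> \<open>With \<open>n = 4\<close> the degree 4 identity reads
    \<open>10 e (-4 + 1) e ^ 4 = 2 e ^ 5\<close>.\<close>
  then have "2 * 2 * 2 * 2 * 2 * e ^ 5 = 0"
    using square(2) unfolding g1 g2' n4 c5 by Groebner_Basis.algebra
  then show False
    using two e by (metis mult_eq_0_iff power_not_zero)
qed

text \<open>Reversal turns the factors \<open>X - x\<close> into \<open>1 - x X\<close>, so leading
  coefficients become low ones, to which Newton's identities apply. The nonzero top coefficient
  makes the degree exactly \<open>n\<close>, so that \<open>k\<close> corresponds to
  \<open>n - k\<close>.\<close>

lemma coeff_reversed_square_shift_poly:
  fixes S :: "'a::field set"
  assumes "finite S" and n: "n = 2 * card S" and "0 < n"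
    and S: "\<And>x. x \<in> S \<Longrightarrow> (x + u) ^ n = 1 \<and> (x + v) ^ n = 1"
    and "of_nat (n + 1) * (u - v) \<noteq> 0" and "k < n"
  shows "of_nat (n + 1) * (u - v) * coeff ((\<Prod>x\<in>S. [:1, -x:]) ^ 2) k =
    of_nat ((n + 1) choose (k + 1)) * (u ^ (k + 1) - v ^ (k + 1))"
proof -
  let ?F = "shift_poly n u v (u - v)"
  have "coeff ?F n \<noteq> 0"
    using assms(5) by (subst coeff_shift_poly_top[OF \<open>0 < n\<close>])
  then have deg: "degree ?F = n"
    using degree_shift_poly_le[of n u v "u - v"] le_degree[of ?F n] by simp
  have lin: "reflect_poly [:-x, 1:] = [:1, -x:]" for x :: 'a
    by (simp add: reflect_poly_def)
  have "?F = smult (of_nat (n + 1) * (u - v)) ((\<Prod>x\<in>S. [:-x, 1:]) ^ 2)"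
    by (rule shift_poly_eq_square) (use assms in auto)
  then have "reflect_poly ?F = smult (of_nat (n + 1) * (u - v)) ((\<Prod>x\<in>S. [:1, -x:]) ^ 2)"
    by (simp only: reflect_poly_smult reflect_poly_power reflect_poly_prod lin)
  then have "of_nat (n + 1) * (u - v) * coeff ((\<Prod>x\<in>S. [:1, -x:]) ^ 2) k = coeff (reflect_poly ?F) k"
    by simp
  also have "\<dots> = coeff ?F (n - k)"
    using \<open>k < n\<close> by (simp add: coeff_reflect_poly deg)
  \<comment> \<open>The bound \<open>k < n\<close> keeps the index positive, away from the constant
    subtracted in \<open>?F\<close>.\<close>
  also have "\<dots> = of_nat ((n + 1) choose (n - k)) * (u ^ (k + 1) - v ^ (k + 1))"
    using \<open>k < n\<close> by (subst coeff_shift_poly) (auto simp: algebra_simps Suc_diff_le)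
  also have "(n + 1) choose (n - k) = (n + 1) choose (k + 1)"
    using \<open>k < n\<close> by (subst binomial_symmetric) (auto simp: Suc_diff_le)
  finally show ?thesis .
qed

lemma card_eq_2_or_4_if_translate_cover:
  fixes A :: "'a::{field,finite} set"
  assumes A: "A = {x. x ^ card A = 1}" and pos: "0 < card A"
    and Q: "A = Q \<union> (\<lambda>x. x + d) ` Q" and d: "d \<noteq> 0"
    and proper: "A \<noteq> UNIV - {0}" and gen: "adjoin A = UNIV"
  shows "card A \<in> {2, 4}"
proof (rule ccontr)
  define n where "n = card A"
  note n1 = of_nat_Suc_card_nonzero[OF assms]
  note cover = translate_cover_card[OF A pos Q d n1]
  assume "card A \<notin> {2, 4}"
  then have "card A \<noteq> 2" "card A \<noteq> 4"
    by auto
  moreover have "card A \<noteq> 0" "even (card A)"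
    using pos cover(1) by auto
  \<comment> \<open>Hence the power sums of degrees 1, 2 and 4 are available, and
    \<open>m = 5\<close> is admissible in \<open>square\<close>.\<close>
  ultimately have "4 < n"
    unfolding n_def by presburger
  have unit: "x ^ n = 1" if "x \<in> A" for x
    using that A unfolding n_def by blast
  have n0: "of_nat n \<noteq> (0::'a)"
    unfolding n_def by (rule of_nat_card_roots_of_unity_nonzero[OF A pos])
  have two: "(2::'a) \<noteq> 0"
    using n0 unfolding n_def cover(1) by auto
  \<comment> \<open>The even number \<open>n\<close> is nonzero in the field, so \<open>d\<close>
    can be halved. Then \<open>A\<close> is the union of \<open>R - e\<close> and
    \<open>R + e\<close>, whose symmetry removes the odd powers of \<open>e\<close> from the power
    sum identities.\<close>
  define e where "e = d / 2"
  have e: "d = 2 * e" "e \<noteq> 0"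
    using two d by (auto simp: e_def)
  define R where "R = (\<lambda>x. x + e) ` Q"
  have cardR: "card R = card Q"
    unfolding R_def by (intro card_image) simp
  have n2: "n = 2 * card R"
    unfolding n_def cardR by (rule cover(1))
  have R: "(x + e) ^ n = 1 \<and> (x + - e) ^ n = 1" if "x \<in> R" for x
  proof -
    obtain y where y: "x = y + e" "y \<in> Q"
      using \<open>x \<in> R\<close> unfolding R_def by blast
    then have "y \<in> A" "y + d \<in> A"
      using Q by auto
    then show ?thesis
      using unit[of y] unit[of "y + d"] y(1) e(1) by (simp add: algebra_simps)
  qed
  have moment: "(\<Sum>x\<in>R. (x - e) ^ j + (x + e) ^ j) = 0" if "0 < j" "j < n" for j
  proof -
    have "(\<Sum>x\<in>R. (x - e) ^ j + (x + e) ^ j) = (\<Sum>x\<in>Q. x ^ j + (x + d) ^ j)"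
      unfolding R_def by (subst sum.reindex) (auto simp: e(1) add.assoc simp flip: mult_2)
    also have "\<dots> = (\<Sum>x\<in>Q. x ^ j) + (\<Sum>x\<in>(\<lambda>x. x + d) ` Q. x ^ j)"
      by (subst sum.reindex) (auto simp: sum.distrib)
    also have "\<dots> = (\<Sum>x\<in>A. x ^ j)"
      by (subst Q, subst sum.union_disjoint) (auto simp: cover(2))
    also have "\<dots> = 0"
      using sum_power_roots_of_unity[OF A] that unfolding n_def by blast
    finally show ?thesis .
  qed
  define P where "P j = (\<Sum>x\<in>R. x ^ j)" for j
  define W where "W = (\<Prod>x\<in>R. [:1, -x:])"
  have W0: "coeff W 0 = 1"
    by (simp add: W_def poly_prod flip: poly_0_coeff_0)
  have newton: "of_nat (Suc k) * coeff W (Suc k) = - (\<Sum>i\<le>k. P (Suc i) * coeff W (k - i))" for k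
    using newton_identity[of R k] by (simp only: W_def P_def finite)
  have square: "of_nat (n + 1) * (2 * e) * coeff (W ^ 2) (m - 1) = of_nat ((n + 1) choose m) * (2 * e ^ m)"
    if "odd m" "m \<le> n" for m
  proof -
    have "0 < m"
      using that(1) by (rule odd_pos)
    have "e - - e = 2 * e" "e ^ m - (- e) ^ m = 2 * e ^ m"
      using that(1) by simp_all
    moreover have "of_nat (n + 1) * (2 * e) \<noteq> 0"
      using n1 e(2) two unfolding n_def by simp
    moreover have "m - 1 < n" "m - 1 + 1 = m"
      using \<open>0 < m\<close> that(2) by simp_all
    ultimately show ?thesis
      using coeff_reversed_square_shift_poly[of R n e "- e" "m - 1"] n2 R \<open>4 < n\<close> unfolding W_def by simp
  qed
  \<comment> \<open>The bound on \<open>k\<close> makes the subtraction \<open>n + 1 - k\<close>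
    exact, so it carries over to the field.\<close>
  have binom: "of_nat (Suc k) * of_nat ((n + 1) choose Suc k) =
      (of_nat (n + 1) - of_nat k) * (of_nat ((n + 1) choose k) :: 'a)" if "k \<le> n" for k
    using binomial_Suc_right[of k "n + 1"] that
    by (metis of_nat_diff of_nat_mult add.commute trans_le_add2)
  show False
  proof (rule square_coeffs_contradiction[where n = "of_nat n" and h = "of_nat (card R)" and e = e
        and ?g1.0 = "coeff W 1" and ?g2.0 = "coeff W 2" and ?g3.0 = "coeff W 3" and ?g4.0 = "coeff W 4"
        and ?P1.0 = "P 1" and ?P2.0 = "P 2" and ?P3.0 = "P 3" and ?P4.0 = "P 4"
        and ?c3.0 = "of_nat ((n + 1) choose 3)" and ?c5.0 = "of_nat ((n + 1) choose 5)"])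
    show "of_nat n + 1 \<noteq> (0::'a)"
      using n1 by (simp add: n_def add.commute)
    show "of_nat n = 2 * (of_nat (card R) :: 'a)"
      by (simp add: n2)
    have "(\<Sum>x\<in>R. (x - e) ^ 1 + (x + e) ^ 1) = 2 * P 1"
      unfolding P_def sum_distrib_left by (intro sum.cong) auto
    then show "2 * P 1 = 0"
      using moment[of 1] \<open>4 < n\<close> by simp
    have "(x - e) ^ 2 + (x + e) ^ 2 = 2 * x ^ 2 + 2 * e ^ 2" for x
      by Groebner_Basis.algebra
    then have "(\<Sum>x\<in>R. (x - e) ^ 2 + (x + e) ^ 2) = 2 * P 2 + 2 * of_nat (card R) * e ^ 2"
      unfolding P_def sum_distrib_left by (simp add: sum.distrib mult_ac)
    then show "2 * P 2 + 2 * of_nat (card R) * e ^ 2 = 0"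
      using moment[of 2] \<open>4 < n\<close> by simp
    have "(x - e) ^ 4 + (x + e) ^ 4 = 2 * x ^ 4 + 12 * e ^ 2 * x ^ 2 + 2 * e ^ 4" for x
      by Groebner_Basis.algebra
    then have "(\<Sum>x\<in>R. (x - e) ^ 4 + (x + e) ^ 4) =
        2 * P 4 + 12 * e ^ 2 * P 2 + 2 * of_nat (card R) * e ^ 4"
      unfolding P_def sum_distrib_left by (simp add: sum.distrib mult_ac)
    then show "2 * P 4 + 12 * e ^ 2 * P 2 + 2 * of_nat (card R) * e ^ 4 = 0"
      using moment[of 4] \<open>4 < n\<close> by simp
    show "coeff W 1 = - P 1"
      using newton[of 0] by (simp add: W0)
    show "2 * coeff W 2 = - (P 1 * coeff W 1 + P 2)"
      using newton[of 1] by (simp add: W0 numeral_2_eq_2)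
    show "4 * coeff W 4 = - (P 1 * coeff W 3 + P 2 * coeff W 2 + P 3 * coeff W 1 + P 4)"
      using newton[of 3] by (simp add: W0 eval_nat_numeral)
    have "coeff (W ^ 2) 2 = 2 * coeff W 2 + coeff W 1 ^ 2"
      by (simp add: W0 power2_eq_square coeff_mult eval_nat_numeral)
    then show "(of_nat n + 1) * (2 * e) * (2 * coeff W 2 + coeff W 1 ^ 2) =
        of_nat ((n + 1) choose 3) * (2 * e ^ 3)"
      using square[of 3] \<open>4 < n\<close> by (simp add: add.commute)
    have "coeff (W ^ 2) 4 = 2 * coeff W 4 + 2 * coeff W 1 * coeff W 3 + coeff W 2 ^ 2"
      by (simp add: W0 power2_eq_square coeff_mult eval_nat_numeral)
    then show "(of_nat n + 1) * (2 * e) * (2 * coeff W 4 + 2 * coeff W 1 * coeff W 3 + coeff W 2 ^ 2) =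
        of_nat ((n + 1) choose 5) * (2 * e ^ 5)"
      using square[of 5] \<open>4 < n\<close> by (simp add: add.commute)
    have b2: "2 * (of_nat ((n + 1) choose 2) :: 'a) = of_nat n * (of_nat n + 1)"
      using binom[of 1] \<open>4 < n\<close> by (simp add: numeral_2_eq_2 algebra_simps)
    have b3: "3 * (of_nat ((n + 1) choose 3) :: 'a) = (of_nat n - 1) * of_nat ((n + 1) choose 2)"
      using binom[of 2] \<open>4 < n\<close> by (simp add: eval_nat_numeral algebra_simps)
    have b4: "4 * (of_nat ((n + 1) choose 4) :: 'a) = (of_nat n - 2) * of_nat ((n + 1) choose 3)"
      using binom[of 3] \<open>4 < n\<close> by (simp add: eval_nat_numeral algebra_simps)
    have b5: "5 * (of_nat ((n + 1) choose 5) :: 'a) = (of_nat n - 3) * of_nat ((n + 1) choose 4)"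
      using binom[of 4] \<open>4 < n\<close> by (simp add: eval_nat_numeral algebra_simps)
    show "6 * of_nat ((n + 1) choose 3) = (of_nat n + 1) * of_nat n * (of_nat n - (1::'a))"
      using b2 b3 by Groebner_Basis.algebra
    show "20 * of_nat ((n + 1) choose 5) = of_nat ((n + 1) choose 3) * (of_nat n - 2) * (of_nat n - (3::'a))"
      using b4 b5 by Groebner_Basis.algebra
  qed (use two e n0 in auto)
qed

section \<open>Progressions with 1, 2 and 4 points\<close>

lemma is_gap_singleton: "is_gap {a}"
  unfolding is_gap_def gap_of_rank_def by (intro exI[of _ "0::nat"] exI[of _ a]) auto

lemma is_gap_pair:
  fixes a d :: "'a::ab_group_add"
  assumes "d \<noteq> 0"
  shows "is_gap {a, a + d}"
proof -
  let ?P = "{a + (\<Sum>i<1::nat. \<Sum>j<n i. d) | n. \<forall>i<1. n i \<le> (2::nat) - 1}"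
  have mem: "a + (\<Sum>j<k. d) \<in> ?P" if "k \<le> 1" for k :: nat
    using that by (intro CollectI exI[of _ "\<lambda>_. k"]) auto
  have "{a, a + d} = ?P"
  proof (intro equalityI subsetI)
    fix x assume "x \<in> {a, a + d}"
    then show "x \<in> ?P"
      using mem[of 0] mem[of 1] by auto
  next
    fix x assume "x \<in> ?P"
    then obtain n :: "nat \<Rightarrow> nat" where "x = a + (\<Sum>j<n 0. d)" "n 0 \<le> 1"
      by auto
    then show "x \<in> {a, a + d}"
      by (cases "n 0") auto
  qed
  then show ?thesis
    unfolding is_gap_def gap_of_rank_def using assms
    by (intro exI[of _ 1] exI[of _ a] exI[of _ "\<lambda>_. 2"] exI[of _ "\<lambda>_. d"]) auto
qed

lemma is_gap_parallelogram:
  fixes a b c :: "'a::ab_group_add"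
  assumes "b \<noteq> 0" "c \<noteq> 0"
  shows "is_gap {a, a + b, a + c, a + (b + c)}"
proof -
  define d where "d i = (if i = 0 then b else c)" for i :: nat
  let ?P = "{a + (\<Sum>i<2::nat. \<Sum>j<n i. d i) | n. \<forall>i<2::nat. n i \<le> (2::nat) - 1}"
  have mem: "a + ((\<Sum>j<k. b) + (\<Sum>j<l. c)) \<in> ?P" if "k \<le> 1" "l \<le> 1" for k l :: nat
    using that by (intro CollectI exI[of _ "\<lambda>i. if i = 0 then k else l"])
      (auto simp: d_def numeral_2_eq_2)
  have "{a, a + b, a + c, a + (b + c)} = ?P"
  proof (intro equalityI subsetI)
    fix x assume "x \<in> {a, a + b, a + c, a + (b + c)}"
    then show "x \<in> ?P"
      using mem[of 0 0] mem[of 1 0] mem[of 0 1] mem[of 1 1] by auto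
  next
    fix x assume "x \<in> ?P"
    then obtain n :: "nat \<Rightarrow> nat" where n: "x = a + (\<Sum>i<2::nat. \<Sum>j<n i. d i)" "\<forall>i<2. n i \<le> 1"
      by auto
    then have "x = a + ((\<Sum>j<n 0. b) + (\<Sum>j<n 1. c))" "n 0 = 0 \<or> n 0 = 1" "n 1 = 0 \<or> n 1 = 1"
      by (auto simp: d_def numeral_2_eq_2 le_Suc_eq)
    then show "x \<in> {a, a + b, a + c, a + (b + c)}"
      by auto
  qed
  then show ?thesis
    unfolding is_gap_def gap_of_rank_def using assms
    by (intro exI[of _ 2] exI[of _ a] exI[of _ "\<lambda>_. 2"] exI[of _ d]) (auto simp: d_def)
qed

lemma is_gap_roots_of_unity:
  fixes A :: "'a::{field,finite} set"
  assumes A: "A = {x. x ^ card A = 1}" and card: "card A \<in> {1, 2, 4}"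
  shows "is_gap A"
proof (cases "card A = 1")
  case True
  then show ?thesis
    by (metis card_1_singletonE is_gap_singleton)
next
  case False
  then have even: "card A = 2 \<or> card A = 4"
    using card by auto
  have "of_nat (card A) \<noteq> (0::'a)"
    using of_nat_card_roots_of_unity_nonzero[OF A] card by auto
  then have two: "(2::'a) \<noteq> 0"
    using even by (metis mult_2 numeral_Bit0 of_nat_numeral mult_zero_left)
  then have neg1: "(1::'a) \<noteq> - 1"
    by (simp add: eq_neg_iff_add_eq_0)
  have sub: "{1, - 1} \<subseteq> A"
    using even by (subst A) auto
  have card2: "card {1, - 1 :: 'a} = 2"
    using neg1 by simp
  show ?thesis
  proof (cases "card A = 2")
    case True
    then have "A = {1, 1 + (- 2)}"
      using card_subset_eq[of A "{1, - 1}"] sub card2 by simp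
    then show ?thesis
      using is_gap_pair[of "- 2 :: 'a" 1] two by simp
  next
    case False
    then have card4: "card A = 4"
      using even by simp
    then have "A \<noteq> {1, - 1}"
      using card2 by auto
    then obtain i where i: "i \<in> A" "i \<noteq> 1" "i \<noteq> - 1"
      using sub by blast
    have "i ^ 4 = 1"
      using i(1) A card4 by auto
    moreover have "(i - 1) * (i + 1) * (i * i + 1) = i ^ 4 - 1"
      by Groebner_Basis.algebra
    ultimately have "(i - 1) * (i + 1) * (i * i + 1) = 0"
      by simp
    then have ii: "i * i = - 1"
      using i(2,3) by (auto simp: eq_neg_iff_add_eq_0)
    have "i \<noteq> 0"
      using ii by auto
    then have "i \<noteq> - i"
      using two by (simp add: eq_neg_iff_add_eq_0 flip: mult_2)
    have "{1, i, - i, - 1} = A"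
    proof (rule card_subset_eq)
      show "{1, i, - i, - 1} \<subseteq> A"
        using sub \<open>i ^ 4 = 1\<close> i(1) card4 by (subst A) auto
      show "card {1, i, - i, - 1} = card A"
        using card4 neg1 i \<open>i \<noteq> - i\<close> by (auto simp: card_insert_if minus_equation_iff[of i])
    qed simp
    \<comment> \<open>The fourth roots of unity form a parallelogram with corner 1 and sides leading
      from 1 to \<open>i\<close> and to \<open>-i\<close>.\<close>
    moreover have "{1, 1 + (i - 1), 1 + (- 1 - i), 1 + ((i - 1) + (- 1 - i))} = {1, i, - i, - 1}"
      by simp
    moreover have "i - 1 \<noteq> 0" "- 1 - i \<noteq> 0"
      using i by auto
    ultimately show ?thesis
      using is_gap_parallelogram[of "i - 1" "- 1 - i" 1] by simp
  qed
qed

section \<open>The equivalence\<close>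

theorem theorem1p2:
  fixes p f k :: nat and A :: "'a::{field,finite} set"
  assumes "prime p" and "f \<ge> 1" and "CARD('a) = p ^ f"
    and "k dvd p ^ f - 1"
    and "A = power_subgroup k"
    and "A \<noteq> UNIV - {0}"
    and "adjoin A = UNIV"
  shows "is_gap A \<longleftrightarrow> card A \<in> {1, 2, 4}"
proof
  note A = power_subgroup_eq_roots_of_unity[OF assms(5)]
  show "is_gap A" if "card A \<in> {1, 2, 4}"
    using A(1) that by (rule is_gap_roots_of_unity)
  assume "is_gap A"
  then show "card A \<in> {1, 2, 4}"
  proof (cases rule: is_gap_cases)
    case (2 Q d)
    then show ?thesis
      using card_eq_2_or_4_if_translate_cover[OF A 2(2,1) assms(6,7)] by auto
  qed simp
qed

end
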